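(* Let $\lambda>0$ and let $\hat\beta$ be the square-root Lasso, i.e. a minimizer over $\beta\in\mathbb{R}^p$ of $\|Y-X\beta\|_n+\lambda\|\beta\|_1$, where $Y=X\beta^0+\epsilon$, and let $\hat\epsilon:=Y-X\hat\beta$. Let $\hat\lambda_0\ge0$ satisfy $$\hat\lambda_0\|\hat\epsilon\|_n\ge\|\epsilon^TX\|_\infty/n .$$ Define, for $\lambda>\hat\lambda_0$, $$\hat L:=\frac{\lambda+\hat\lambda_0}{\lambda-\hat\lambda_0}.$$ Then $$\|X(\hat\beta-\beta^0)\|_n^2\le\min_{S\subset\{1,\dots,p\}}\ \min_{\beta\in\mathbb{R}^p,\ S_\beta=S}\Big\{\|X(\beta-\beta^0)\|_n^2+(\lambda+\hat\lambda_0)^2\|\hat\epsilon\|_n^2\frac{|S|}{\hat\phi^2(\hat L,S)}\Big\}.$$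
   Context: $X$ is a fixed $n\times p$ real matrix of rank $n$, $Y\in\mathbb{R}^n$, $f^0=\mathbb{E}Y$, $\beta^0\in\mathbb{R}^p$ is a solution of $X\beta^0=f^0$, and $\epsilon:=Y-f^0$, so $Y=X\beta^0+\epsilon$ (the result is deterministic: it holds for any realization of $\epsilon$). For $v\in\mathbb{R}^n$, $\|v\|_n:=\sqrt{v^Tv/n}$. For $\beta\in\mathbb{R}^p$, $S_\beta:=\{j:\beta_j\ne0\}$. For $S\subset\{1,\dots,p\}$, $\beta_S\in\mathbb{R}^p$ has entries $\beta_j$ for $j\in S$ and $0$ otherwise. The compatibility constant, for $L>0$, is $$\hat\phi^2(L,S):=\min\{|S|\,\|X\beta_S-X\beta_{S^c}\|_n^2:\ \|\beta_S\|_1=1,\ \|\beta_{S^c}\|_1\le L\}.$$ Conventions: minima over $\beta$ with $S_\beta=S$ are understood as infima (i.e. the inequality holds for every $\beta$, with $S=S_\beta$); the term containing $|S|/\hat\phi^2(\hat L,S)$ is $0$ if $S=\emptyset$ and $+\infty$ if $S\ne\emptyset$ and $\hat\phi(\hat L,S)=0$. *)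

theory Defs
  imports "HOL-Analysis.Analysis"
begin

definition norm_n :: "real ^ 'n \<Rightarrow> real" where
  "norm_n v = sqrt ((v \<bullet> v) / real CARD('n))"

definition norm_l1 :: "real ^ 'p \<Rightarrow> real" where
  "norm_l1 b = (\<Sum>j\<in>UNIV. \<bar>b $ j\<bar>)"

definition supp :: "real ^ 'p \<Rightarrow> 'p set" where
  "supp b = {j. b $ j \<noteq> 0}"

definition restrict_vec :: "real ^ 'p \<Rightarrow> 'p set \<Rightarrow> real ^ 'p" where
  "restrict_vec b S = (\<chi> j. if j \<in> S then b $ j else 0)"

text \<open>The squared compatibility constant. For nonempty \<open>S\<close> and \<open>L \<ge> 0\<close> the set is the continuous
  image of a nonempty compact set (in the relevant coordinates), so the infimum is a minimum. For
  \<open>S = {}\<close> the set is empty and the value is unspecified.\<close>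

definition compat_sq :: "real ^ 'p ^ 'n \<Rightarrow> real \<Rightarrow> 'p set \<Rightarrow> real" where
  "compat_sq X L S =
     Inf {real (card S) * (norm_n (X *v restrict_vec b S - X *v restrict_vec b (- S)))\<^sup>2 | b.
            norm_l1 (restrict_vec b S) = 1 \<and> norm_l1 (restrict_vec b (- S)) \<le> L}"

definition is_sqrt_lasso :: "real ^ 'p ^ 'n \<Rightarrow> real ^ 'n \<Rightarrow> real \<Rightarrow> real ^ 'p \<Rightarrow> bool" where
  "is_sqrt_lasso X Y lam bhat \<longleftrightarrow>
     is_arg_min (\<lambda>b. norm_n (Y - X *v b) + lam * norm_l1 b) (\<lambda>_. True) bhat"

text \<open>The term \<open>c |S| / \<phi>\<^sup>2(L, S)\<close>, with value \<open>0\<close> for \<open>S = {}\<close>, and \<open>\<infinity>\<close> for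
  nonempty \<open>S\<close> with vanishing compatibility constant (whatever the factor \<open>c\<close>).\<close>

definition compat_term :: "real ^ 'p ^ 'n \<Rightarrow> real \<Rightarrow> real \<Rightarrow> 'p set \<Rightarrow> ereal" where
  "compat_term X c L S =
     (if S = {} then 0
      else if compat_sq X L S = 0 then \<infinity>
      else ereal (c * (real (card S) / compat_sq X L S)))"

end

theory Submission
  imports Defs
begin

text \<open>
  Differentiating the convex objective at \<open>\<beta>\<^sub>h\<close> along the segment towards \<open>\<beta>\<close> gives the
  variational inequality \<open>\<epsilon>\<^sub>h\<^sup>T X(\<beta> - \<beta>\<^sub>h) / n \<le> \<lambda> \<parallel>\<epsilon>\<^sub>h\<parallel>\<^sub>n (\<parallel>\<beta>\<parallel>\<^sub>1 - \<parallel>\<beta>\<^sub>h\<parallel>\<^sub>1)\<close>,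
  where \<open>\<epsilon>\<^sub>h = Y - X\<beta>\<^sub>h\<close>.
  Inserting \<open>\<epsilon>\<^sub>h = \<epsilon> - X(\<beta>\<^sub>h - \<beta>\<^sup>0)\<close>, polarising, and bounding the noise term by duality
  yields, with \<open>\<delta> = \<beta>\<^sub>h - \<beta>\<close> and \<open>S\<close> the support of \<open>\<beta>\<close>,
  that \<open>\<parallel>X(\<beta>\<^sub>h - \<beta>\<^sup>0)\<parallel>\<^sub>n\<^sup>2 + \<parallel>X\<delta>\<parallel>\<^sub>n\<^sup>2 - \<parallel>X(\<beta> - \<beta>\<^sup>0)\<parallel>\<^sub>n\<^sup>2\<close> is at most
  \<open>2 \<parallel>\<epsilon>\<^sub>h\<parallel>\<^sub>n ((\<lambda> + \<lambda>\<^sub>0) \<parallel>\<delta>\<^sub>S\<parallel>\<^sub>1 - (\<lambda> - \<lambda>\<^sub>0) \<parallel>\<delta>\<^bsub>-S\<^esub>\<parallel>\<^sub>1)\<close>.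
  If \<open>\<parallel>X(\<beta>\<^sub>h - \<beta>\<^sup>0)\<parallel>\<^sub>n\<close> exceeds \<open>\<parallel>X(\<beta> - \<beta>\<^sup>0)\<parallel>\<^sub>n\<close>, then \<open>\<delta>\<close> lies in the cone of the
  compatibility constant, and \<open>\<parallel>X\<delta>\<parallel>\<^sub>n\<^sup>2\<close> is absorbed by the arithmetic-geometric mean inequality.
\<close>

section \<open>Normalised Euclidean and l1 norms\<close>

lemma norm_n_nonneg: "0 \<le> norm_n v"
  by (simp add: norm_n_def)

lemma norm_n_sq: "(norm_n (v :: real ^ 'n))\<^sup>2 = (v \<bullet> v) / real CARD('n)"
  by (simp add: norm_n_def)

lemma norm_n_eq_0_iff: "norm_n v = 0 \<longleftrightarrow> v = 0"
  by (simp add: norm_n_def)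

lemma norm_l1_nonneg: "0 \<le> norm_l1 b"
  by (simp add: norm_l1_def sum_nonneg)

lemma norm_l1_triangle: "norm_l1 (a + b) \<le> norm_l1 a + norm_l1 b"
  unfolding norm_l1_def sum.distrib[symmetric] by (intro sum_mono) simp

lemma norm_l1_scaleR: "norm_l1 (c *\<^sub>R b) = \<bar>c\<bar> * norm_l1 b"
  by (simp add: norm_l1_def abs_mult sum_distrib_left)

lemma norm_l1_restrict_vec: "norm_l1 (restrict_vec b S) = (\<Sum>j\<in>S. \<bar>b $ j\<bar>)"
  unfolding norm_l1_def restrict_vec_def
  by (simp add: if_distrib sum.If_cases cong: if_cong)

lemma norm_l1_split: "norm_l1 b = norm_l1 (restrict_vec b S) + norm_l1 (restrict_vec b (- S))"
  unfolding norm_l1_restrict_vec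
  by (metis Compl_eq_Diff_UNIV add.commute finite norm_l1_def sum.subset_diff top_greatest)

lemma inner_le_infnorm_norm_l1:
  fixes z d :: "real ^ 'p"
  shows "z \<bullet> d \<le> infnorm z * norm_l1 d"
proof -
  have "z $ j * d $ j \<le> infnorm z * \<bar>d $ j\<bar>" for j
  proof -
    have "z $ j * d $ j \<le> \<bar>z $ j\<bar> * \<bar>d $ j\<bar>"
      by (metis abs_ge_self abs_mult)
    also have "\<dots> \<le> infnorm z * \<bar>d $ j\<bar>"
      by (intro mult_right_mono component_le_infnorm_cart) auto
    finally show ?thesis .
  qed
  then show ?thesis
    by (simp add: inner_vec_def norm_l1_def sum_distrib_left sum_mono)
qed

text \<open>Off the support of \<open>b\<close> the vectors \<open>c\<close> and \<open>d\<close>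
  agree, so that part of \<open>norm_l1 c\<close> survives in full; on the support the triangle
  inequality is enough.\<close>

lemma norm_l1_support_diff:
  fixes b c :: "real ^ 'p"
  defines "d \<equiv> c - b"
  shows "norm_l1 b - norm_l1 c \<le>
           norm_l1 (restrict_vec d (supp b)) - norm_l1 (restrict_vec d (- supp b))"
proof -
  let ?S = "supp b"
  have "norm_l1 (restrict_vec b (- ?S)) = 0"
    by (simp add: norm_l1_restrict_vec supp_def)
  moreover have "norm_l1 (restrict_vec c (- ?S)) = norm_l1 (restrict_vec d (- ?S))"
    unfolding norm_l1_restrict_vec by (intro sum.cong) (auto simp: supp_def d_def)
  moreover have "norm_l1 (restrict_vec b ?S) \<le>
      norm_l1 (restrict_vec d ?S) + norm_l1 (restrict_vec c ?S)"
    unfolding norm_l1_restrict_vec sum.distrib[symmetric]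
    by (intro sum_mono) (simp add: d_def)
  ultimately show ?thesis
    using norm_l1_split[of b ?S] norm_l1_split[of c ?S] by linarith
qed

section \<open>Compatibility constant\<close>

lemma compat_sq_le:
  assumes "norm_l1 (restrict_vec b S) = 1" "norm_l1 (restrict_vec b (- S)) \<le> L"
  shows "compat_sq X L S \<le>
    real (card S) * (norm_n (X *v restrict_vec b S - X *v restrict_vec b (- S)))\<^sup>2"
  unfolding compat_sq_def
  by (rule cInf_lower) (use assms in \<open>auto intro!: bdd_belowI[of _ 0]\<close>)

lemma compat_sq_nonneg:
  fixes X :: "real ^ 'p ^ 'n"
  assumes "S \<noteq> {}" "0 \<le> L"
  shows "0 \<le> compat_sq X L S"
proof -
  \<comment> \<open>A lower bound on an \<open>Inf\<close> of reals needs a nonempty set; a basis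
    vector indexed in \<open>S\<close> is feasible.\<close>
  obtain i where i: "i \<in> S" using assms by blast
  define b :: "real ^ 'p" where "b = axis i 1"
  have "norm_l1 (restrict_vec b S) = 1"
    using i by (simp add: norm_l1_restrict_vec b_def axis_def if_distrib cong: if_cong)
  moreover have "norm_l1 (restrict_vec b (- S)) = 0"
    using i by (auto simp: norm_l1_restrict_vec b_def axis_def)
  ultimately show ?thesis
    unfolding compat_sq_def by (intro cInf_greatest) (use assms in auto)
qed

text \<open>Homogeneity: dividing \<open>d\<close> by its l1 mass on \<open>S\<close> meets the
  normalisation in \<open>compat_sq\<close>, and the cone condition becomes the bound by
  \<open>L\<close>.\<close>

lemma compat_sq_cone:
  fixes X :: "real ^ 'p ^ 'n"
  assumes pos: "0 < norm_l1 (restrict_vec d S)"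
    and cone: "norm_l1 (restrict_vec d (- S)) \<le> L * norm_l1 (restrict_vec d S)"
  shows "(norm_l1 (restrict_vec d S))\<^sup>2 * compat_sq X L S \<le> real (card S) * (norm_n (X *v d))\<^sup>2"
proof -
  let ?s = "norm_l1 (restrict_vec d S)"
  \<comment> \<open>The sign flip off \<open>S\<close> matches the difference \<open>X\<beta>\<^sub>S - X\<beta>\<^bsub>-S\<^esub>\<close> in the definition.\<close>
  define b where "b = (1 / ?s) *\<^sub>R (restrict_vec d S - restrict_vec d (- S))"
  have bS: "restrict_vec b S = (1 / ?s) *\<^sub>R restrict_vec d S"
    by (simp add: b_def restrict_vec_def vec_eq_iff)
  have bC: "restrict_vec b (- S) = (- (1 / ?s)) *\<^sub>R restrict_vec d (- S)"
    by (simp add: b_def restrict_vec_def vec_eq_iff)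
  have "restrict_vec b S - restrict_vec b (- S) = (1 / ?s) *\<^sub>R d"
    by (simp add: b_def restrict_vec_def vec_eq_iff)
  then have "X *v restrict_vec b S - X *v restrict_vec b (- S) = (1 / ?s) *\<^sub>R (X *v d)"
    by (simp only: matrix_vector_mult_diff_distrib[symmetric] matrix_vector_mult_scaleR)
  then have eq: "(norm_n (X *v restrict_vec b S - X *v restrict_vec b (- S)))\<^sup>2
      = (norm_n (X *v d))\<^sup>2 / ?s\<^sup>2"
    unfolding norm_n_sq by (simp add: power2_eq_square)
  have "compat_sq X L S \<le> real (card S) * ((norm_n (X *v d))\<^sup>2 / ?s\<^sup>2)"
    unfolding eq[symmetric]
  proof (rule compat_sq_le)
    show "norm_l1 (restrict_vec b S) = 1"
      using pos by (simp add: bS norm_l1_scaleR)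
    show "norm_l1 (restrict_vec b (- S)) \<le> L"
      unfolding bC norm_l1_scaleR using pos cone by (simp add: divide_le_eq)
  qed
  then show ?thesis
    using pos by (simp add: field_simps)
qed

section \<open>Optimality and the oracle bound\<close>

lemma sqrt_lasso_variational_inequality:
  fixes X :: "real ^ 'p ^ 'n"
  assumes lasso: "is_sqrt_lasso X Y lam bh"
    and lam: "0 \<le> lam"
    and nz: "Y - X *v bh \<noteq> 0"
  shows "((Y - X *v bh) \<bullet> (X *v (b - bh))) / real CARD('n)
           \<le> lam * norm_n (Y - X *v bh) * (norm_l1 b - norm_l1 bh)"
proof -
  define e where "e = Y - X *v bh"
  define v where "v = X *v (b - bh)"
  define a where "a = norm_n e"
  define n where "n = real CARD('n)"
  define D where "D = norm_l1 b - norm_l1 bh"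
  have n: "n > 0" by (simp add: n_def)
  have a: "a > 0"
    using nz norm_n_nonneg[of e] norm_n_eq_0_iff[of e] by (auto simp: a_def e_def)
  have step: "a - t * lam * D \<le> norm_n (e - t *\<^sub>R v)" if t: "0 < t" "t \<le> 1" for t
  proof -
    let ?bt = "(1 - t) *\<^sub>R bh + t *\<^sub>R b"
    have "a + lam * norm_l1 bh \<le> norm_n (Y - X *v ?bt) + lam * norm_l1 ?bt"
      using lasso by (auto simp: is_sqrt_lasso_def is_arg_min_def not_less a_def e_def)
    also have "Y - X *v ?bt = e - t *\<^sub>R v"
      by (simp add: e_def v_def matrix_vector_right_distrib matrix_vector_mult_diff_distrib
          matrix_vector_mult_scaleR algebra_simps)
    also have "norm_l1 ?bt \<le> (1 - t) * norm_l1 bh + t * norm_l1 b"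
      using norm_l1_triangle[of "(1 - t) *\<^sub>R bh" "t *\<^sub>R b"] t by (simp add: norm_l1_scaleR)
    finally have "a + lam * norm_l1 bh
        \<le> norm_n (e - t *\<^sub>R v) + lam * ((1 - t) * norm_l1 bh + t * norm_l1 b)"
      using lam by (simp add: mult_left_mono)
    then show ?thesis
      by (simp add: D_def algebra_simps)
  qed
  let ?g = "\<lambda>t. a * lam * D + t / 2 * ((norm_n v)\<^sup>2 - (lam * D)\<^sup>2)"
  have bound: "(e \<bullet> v) / n \<le> ?g t" if t: "0 < t" "t \<le> 1" and small: "0 < a - t * lam * D" for t
  proof -
    \<comment> \<open>Squaring removes the root: \<open>a\<^sup>2\<close> cancels, and division by
      \<open>2 * t\<close> leaves a remainder linear in \<open>t\<close>, which vanishes in the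
      limit.\<close>
    have "(a - t * lam * D)\<^sup>2 \<le> (norm_n (e - t *\<^sub>R v))\<^sup>2"
      using step[OF t] small by (intro power_mono) auto
    also have "\<dots> = a\<^sup>2 - 2 * t * ((e \<bullet> v) / n) + t\<^sup>2 * (norm_n v)\<^sup>2"
      unfolding norm_n_sq a_def n_def[symmetric]
      using n by (simp add: inner_diff_left inner_diff_right inner_commute[of v e]
          power2_eq_square field_simps)
    finally have "(2 * t) * ((e \<bullet> v) / n) \<le> (2 * t) * ?g t"
      by (simp add: power2_eq_square algebra_simps)
    then show ?thesis
      using t by (simp only: mult_le_cancel_left_pos)
  qed
  have "((\<lambda>t. a - t * lam * D) \<longlongrightarrow> a - 0 * lam * D) (at_right 0)"
    by (intro tendsto_intros)
  then have "eventually (\<lambda>t. 0 < a - t * lam * D) (at_right 0)"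
    using a by (intro order_tendstoD(1)) auto
  moreover have "eventually (\<lambda>t::real. 0 < t \<and> t < 1) (at_right 0)"
    using eventually_at_right_real[of 0 1] by (auto elim: eventually_mono)
  ultimately have "eventually (\<lambda>t. (e \<bullet> v) / n \<le> ?g t) (at_right 0)"
    by eventually_elim (intro bound; simp)
  moreover have "(?g \<longlongrightarrow> a * lam * D + 0 / 2 * ((norm_n v)\<^sup>2 - (lam * D)\<^sup>2)) (at_right 0)"
    by (intro tendsto_intros) auto
  ultimately have "(e \<bullet> v) / n \<le> a * lam * D + 0 / 2 * ((norm_n v)\<^sup>2 - (lam * D)\<^sup>2)"
    by (intro tendsto_lowerbound) auto
  then show ?thesis
    by (simp add: e_def v_def n_def a_def D_def mult_ac)
qed

lemma sqrt_lasso_basic_inequality: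
  fixes X :: "real ^ 'p ^ 'n" and b :: "real ^ 'p"
  assumes lasso: "is_sqrt_lasso X Y lam bh"
    and lam: "0 \<le> lam"
    and nz: "Y - X *v bh \<noteq> 0"
    and noise: "infnorm ((Y - X *v b0) v* X) / real CARD('n) \<le> lam0 * norm_n (Y - X *v bh)"
  defines "d \<equiv> bh - b"
  shows "(norm_n (X *v (bh - b0)))\<^sup>2 + (norm_n (X *v d))\<^sup>2 - (norm_n (X *v (b - b0)))\<^sup>2
     \<le> 2 * norm_n (Y - X *v bh) * ((lam + lam0) * norm_l1 (restrict_vec d (supp b))
          - (lam - lam0) * norm_l1 (restrict_vec d (- supp b)))"
proof -
  define a where "a = norm_n (Y - X *v bh)"
  define n where "n = real CARD('n)"
  define e where "e = Y - X *v b0"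
  define s where "s = norm_l1 (restrict_vec d (supp b))"
  define r where "r = norm_l1 (restrict_vec d (- supp b))"
  have n: "n > 0" by (simp add: n_def)
  have vi: "((Y - X *v bh) \<bullet> (X *v (b - bh))) / n \<le> lam * a * (norm_l1 b - norm_l1 bh)"
    using sqrt_lasso_variational_inequality[OF lasso lam nz, of b] by (simp add: a_def n_def)
  also have "\<dots> \<le> lam * a * (s - r)"
    using norm_l1_support_diff[of b bh] lam
    by (intro mult_left_mono mult_nonneg_nonneg) (auto simp: s_def r_def d_def a_def norm_n_nonneg)
  finally have vi: "((Y - X *v bh) \<bullet> (X *v (b - bh))) / n \<le> lam * a * (s - r)" .
  have "e \<bullet> (X *v d) \<le> infnorm (e v* X) * norm_l1 d"
    using inner_le_infnorm_norm_l1[of "e v* X" d] by (simp add: dot_lmul_matrix)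
  then have "e \<bullet> (X *v d) / n \<le> infnorm (e v* X) / n * norm_l1 d"
    using n by (simp add: divide_right_mono)
  also have "\<dots> \<le> lam0 * a * norm_l1 d"
    using noise by (intro mult_right_mono norm_l1_nonneg) (simp add: a_def n_def e_def)
  also have "norm_l1 d = s + r"
    unfolding s_def r_def by (rule norm_l1_split)
  finally have dual: "e \<bullet> (X *v d) / n \<le> lam0 * a * (s + r)" .
  \<comment> \<open>With \<open>u = X *v (bh - b0)\<close> and \<open>w = X *v (b - b0)\<close>, the
    residual is \<open>e - u\<close> and \<open>X *v d = u - w\<close>; both sides equal
    \<open>2 * (u \<bullet> (u - w)) / n\<close>.\<close>
  have "(norm_n (X *v (bh - b0)))\<^sup>2 + (norm_n (X *v d))\<^sup>2 - (norm_n (X *v (b - b0)))\<^sup>2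
      = 2 * ((Y - X *v bh) \<bullet> (X *v (b - bh)) / n + e \<bullet> (X *v d) / n)"
    unfolding norm_n_sq n_def[symmetric] d_def e_def matrix_vector_mult_diff_distrib
    using n by (simp add: field_simps inner_diff_left inner_diff_right inner_commute)
  also have "\<dots> \<le> 2 * (lam * a * (s - r) + lam0 * a * (s + r))"
    using vi dual by simp
  finally show ?thesis
    by (simp add: a_def s_def r_def algebra_simps)
qed

text \<open>For empty support \<open>compat_sq\<close> is unspecified, but the cardinality
  \<open>0\<close> makes the quotient vanish, so \<open>phi\<close> only concerns nonempty
  support.\<close>

lemma sqrt_lasso_oracle_bound:
  fixes X :: "real ^ 'p ^ 'n" and b :: "real ^ 'p"
  assumes lasso: "is_sqrt_lasso X Y lam bh"
    and lam: "0 \<le> lam0" "lam0 < lam"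
    and nz: "Y - X *v bh \<noteq> 0"
    and noise: "infnorm ((Y - X *v b0) v* X) / real CARD('n) \<le> lam0 * norm_n (Y - X *v bh)"
    and phi: "supp b \<noteq> {} \<Longrightarrow> 0 < compat_sq X ((lam + lam0) / (lam - lam0)) (supp b)"
  shows "(norm_n (X *v (bh - b0)))\<^sup>2 \<le> (norm_n (X *v (b - b0)))\<^sup>2
     + (lam + lam0)\<^sup>2 * (norm_n (Y - X *v bh))\<^sup>2 *
       (real (card (supp b)) / compat_sq X ((lam + lam0) / (lam - lam0)) (supp b))"
    (is "?P \<le> ?R + _")
proof -
  let ?S = "supp b"
  let ?L = "(lam + lam0) / (lam - lam0)"
  define d where "d = bh - b"
  define a where "a = norm_n (Y - X *v bh)"
  define s where "s = norm_l1 (restrict_vec d ?S)"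
  define r where "r = norm_l1 (restrict_vec d (- ?S))"
  define q where "q = (norm_n (X *v d))\<^sup>2"
  define m where "m = real (card ?S)"
  define f where "f = compat_sq X ?L ?S"
  have a: "a > 0"
    using nz norm_n_nonneg[of "Y - X *v bh"] norm_n_eq_0_iff[of "Y - X *v bh"]
    by (simp add: a_def less_le)
  have r: "0 \<le> r" and s: "0 \<le> s" by (simp_all add: r_def s_def norm_l1_nonneg)
  have q: "0 \<le> q" by (simp add: q_def)
  have basic: "?P + q - ?R \<le> 2 * a * ((lam + lam0) * s - (lam - lam0) * r)"
    using sqrt_lasso_basic_inequality[OF lasso _ nz noise, of b] lam
    by (simp add: a_def s_def r_def q_def d_def)
  have "?P \<le> ?R + (lam + lam0)\<^sup>2 * a\<^sup>2 * (m / f)"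
  proof (cases "?P \<le> ?R")
    case True
    have "0 \<le> m / f"
    proof (cases "?S = {}")
      case False
      then show ?thesis using phi by (simp add: m_def f_def)
    qed (simp add: m_def)
    then have "0 \<le> (lam + lam0)\<^sup>2 * a\<^sup>2 * (m / f)" by (intro mult_nonneg_nonneg) auto
    with True show ?thesis by linarith
  next
    case False
    with basic q have "0 < 2 * a * ((lam + lam0) * s - (lam - lam0) * r)" by linarith
    with a have cone: "(lam - lam0) * r < (lam + lam0) * s"
      by (simp add: zero_less_mult_iff)
    moreover have "0 \<le> (lam - lam0) * r" using lam r by simp
    ultimately have "0 < (lam + lam0) * s" by linarith
    then have s_pos: "0 < s" using s by (cases "s = 0") auto
    then have ne: "?S \<noteq> {}" by (auto simp: s_def norm_l1_restrict_vec)
    then have m: "0 < m" and f: "0 < f" using phi by (auto simp: m_def f_def card_gt_0_iff)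
    have "r \<le> ?L * s" using cone lam by (simp add: field_simps)
    then have compat: "s\<^sup>2 * f \<le> m * q"
      using compat_sq_cone[of d ?S ?L X] s_pos by (simp add: s_def r_def q_def m_def f_def)
    have "?P + q - ?R \<le> 2 * a * ((lam + lam0) * s)"
    proof -
      have "2 * a * ((lam + lam0) * s - (lam - lam0) * r) \<le> 2 * a * ((lam + lam0) * s)"
        using a lam r by (intro mult_left_mono) auto
      with basic show ?thesis by linarith
    qed
    also have "\<dots> = 2 * ((lam + lam0) * a) * s" by simp
    also have "\<dots> \<le> ((lam + lam0) * a)\<^sup>2 * (m / f) + s\<^sup>2 * f / m"
    proof -
      \<comment> \<open>The weights are chosen so that the second term becomes
        \<open>s\<^sup>2 * f / m\<close>, which \<open>compat\<close> bounds by
        \<open>q\<close>.\<close>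
      have "0 \<le> ((lam + lam0) * a * m - s * f)\<^sup>2 / (m * f)" using m f by simp
      also have "\<dots> = ((lam + lam0) * a)\<^sup>2 * (m / f) + s\<^sup>2 * f / m - 2 * ((lam + lam0) * a) * s"
        using m f by (simp add: field_simps power2_eq_square)
      finally show ?thesis by simp
    qed
    also have "s\<^sup>2 * f / m \<le> q" using compat m by (simp add: field_simps)
    finally show ?thesis by (simp add: power_mult_distrib)
  qed
  then show ?thesis by (simp add: a_def m_def f_def)
qed

text \<open>Full row rank makes \<open>e\<close> an image \<open>X *v d\<close>, so \<open>e\<close>
  is orthogonal to itself.\<close>

lemma full_rank_vector_matrix_mult_eq_0:
  fixes X :: "real ^ 'p ^ 'n"
  assumes "rank X = CARD('n)" "e v* X = 0"
  shows "e = 0"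
proof -
  have "surj ((*v) X)" using assms(1) by (simp add: full_rank_surjective)
  then obtain d where "X *v d = e" by (metis surjD)
  then have "e \<bullet> e = (e v* X) \<bullet> d" by (simp add: dot_lmul_matrix)
  with assms(2) show ?thesis by simp
qed

lemma compat_term_nonneg:
  assumes "0 \<le> c" "0 \<le> L"
  shows "0 \<le> compat_term X c L S"
  using assms compat_sq_nonneg[of S L X] by (auto simp: compat_term_def)

theorem proposition1p4p1:
  fixes X :: "real ^ 'p ^ 'n"
    and Y f0 eps eps_hat :: "real ^ 'n"
    and beta0 beta_hat :: "real ^ 'p"
    and lam lam0 L_hat :: real
  assumes rank_X: "rank X = CARD('n)"
    and beta0: "X *v beta0 = f0"
    and eps: "eps = Y - f0"
    and lam_pos: "lam > 0"
    and lasso: "is_sqrt_lasso X Y lam beta_hat"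
    and eps_hat: "eps_hat = Y - X *v beta_hat"
    and lam0_nonneg: "lam0 \<ge> 0"
    and lam0: "lam0 * norm_n eps_hat \<ge> infnorm (eps v* X) / real CARD('n)"
    and lam_gt: "lam > lam0"
    and L_hat: "L_hat = (lam + lam0) / (lam - lam0)"
  shows "ereal ((norm_n (X *v (beta_hat - beta0)))\<^sup>2) \<le>
           (INF S \<in> (UNIV :: 'p set set). INF beta \<in> {b. supp b = S}.
              ereal ((norm_n (X *v (beta - beta0)))\<^sup>2)
              + compat_term X ((lam + lam0)\<^sup>2 * (norm_n eps_hat)\<^sup>2) L_hat S)"
proof (intro INF_greatest, clarify)
  fix beta :: "real ^ 'p"
  let ?c = "(lam + lam0)\<^sup>2 * (norm_n eps_hat)\<^sup>2"
  have L: "0 \<le> L_hat" using lam_pos lam0_nonneg lam_gt by (simp add: L_hat)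
  show "ereal ((norm_n (X *v (beta_hat - beta0)))\<^sup>2) \<le>
      ereal ((norm_n (X *v (beta - beta0)))\<^sup>2) + compat_term X ?c L_hat (supp beta)"
  proof (cases "eps_hat = 0")
    case True
    \<comment> \<open>Here the assumption on \<open>lam0\<close> forces \<open>eps v* X = 0\<close>; the rank condition then gives \<open>eps = 0\<close>.\<close>
    then have "norm_n eps_hat = 0" by (simp add: norm_n_eq_0_iff)
    with lam0 have "infnorm (eps v* X) \<le> 0" by (simp add: divide_le_0_iff)
    then have "eps v* X = 0" by (metis infnorm_eq_0 infnorm_pos_le order_antisym)
    then have "eps = 0" by (rule full_rank_vector_matrix_mult_eq_0[OF rank_X])
    then have "X *v (beta_hat - beta0) = 0"
      using True eps eps_hat beta0 by (simp add: matrix_vector_mult_diff_distrib)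
    then have "(norm_n (X *v (beta_hat - beta0)))\<^sup>2 = 0" by (simp add: norm_n_eq_0_iff)
    moreover have "0 \<le> ereal ((norm_n (X *v (beta - beta0)))\<^sup>2) + compat_term X ?c L_hat (supp beta)"
      by (intro add_nonneg_nonneg compat_term_nonneg L) auto
    ultimately show ?thesis by (simp add: zero_ereal_def)
  next
    case False
    show ?thesis
    proof (cases "supp beta \<noteq> {} \<and> compat_sq X L_hat (supp beta) = 0")
      case True
      then show ?thesis by (simp add: compat_term_def)
    next
      case nondegenerate: False
      then have "0 < compat_sq X L_hat (supp beta)" if "supp beta \<noteq> {}"
        using compat_sq_nonneg[OF that L, of X] that by simp
      then have "(norm_n (X *v (beta_hat - beta0)))\<^sup>2 \<le> (norm_n (X *v (beta - beta0)))\<^sup>2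
          + ?c * (real (card (supp beta)) / compat_sq X L_hat (supp beta))"
        using sqrt_lasso_oracle_bound[OF lasso lam0_nonneg lam_gt, of beta0 beta]
          False lam0 by (simp add: eps_hat eps beta0 L_hat)
      then show ?thesis
        using nondegenerate by (auto simp: compat_term_def)
    qed
  qed
qed

end
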